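(* Let $(G,w)$ be a tree-like graph with $\Delta(G)\le 2^{\aleph_0}$. Then $a(G)=2^{|G|}$.
   Context: A tree-like graph is a rooted connected graph $(G,w)$ in which each vertex $y$ has a neighbor $x$ such that $y$ lies on every shortest $x$–$w$ path. $\Delta(G)$ is the least upper bound of the vertex degrees of $G$. A set $S\subseteq V(G)$ is asymmetrizing if the identity is the only automorphism of $G$ (as an unrooted graph) mapping $S$ onto itself; two asymmetrizing sets $S,S'$ are equivalent if some automorphism $\varphi$ of $G$ has $\varphi(S)=S'$; $a(G)$ is the number of pairwise inequivalent asymmetrizing sets of $G$. *)

theory Defs
  imports Main
begin

unbundle cardinal_syntax

section \<open>Graphs\<close>

text \<open>Graphs are simple, undirected and possibly infinite: a vertex set \<open>V\<close> together with a
  set \<open>E\<close> of two-element subsets of \<open>V\<close>.\<close>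

definition simple_graph :: "'a set \<Rightarrow> 'a set set \<Rightarrow> bool" where
  "simple_graph V E \<longleftrightarrow> (\<forall>e\<in>E. \<exists>u\<in>V. \<exists>v\<in>V. u \<noteq> v \<and> e = {u, v})"

definition neighbors :: "'a set set \<Rightarrow> 'a \<Rightarrow> 'a set" where
  "neighbors E v = {u. {v, u} \<in> E}"

text \<open>A path is given by the list of its vertices; \<open>[v]\<close> is the trivial path from \<open>v\<close> to \<open>v\<close>.\<close>

definition is_path :: "'a set \<Rightarrow> 'a set set \<Rightarrow> 'a \<Rightarrow> 'a list \<Rightarrow> 'a \<Rightarrow> bool" where
  "is_path V E x p y \<longleftrightarrow>
     p \<noteq> [] \<and> hd p = x \<and> last p = y \<and> set p \<subseteq> V \<and> distinct p \<and>
     successively (\<lambda>u v. {u, v} \<in> E) p"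

definition is_shortest_path :: "'a set \<Rightarrow> 'a set set \<Rightarrow> 'a \<Rightarrow> 'a list \<Rightarrow> 'a \<Rightarrow> bool" where
  "is_shortest_path V E x p y \<longleftrightarrow>
     is_path V E x p y \<and> (\<forall>q. is_path V E x q y \<longrightarrow> length p \<le> length q)"

definition connected_graph :: "'a set \<Rightarrow> 'a set set \<Rightarrow> bool" where
  "connected_graph V E \<longleftrightarrow>
     simple_graph V E \<and> V \<noteq> {} \<and> (\<forall>x\<in>V. \<forall>y\<in>V. \<exists>p. is_path V E x p y)"

definition tree_like :: "'a set \<Rightarrow> 'a set set \<Rightarrow> 'a \<Rightarrow> bool" where
  "tree_like V E w \<longleftrightarrow>
     connected_graph V E \<and> w \<in> V \<and>
     (\<forall>y\<in>V. \<exists>x\<in>neighbors E y. \<forall>p. is_shortest_path V E x p w \<longrightarrow> y \<in> set p)"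


section \<open>The least upper bound of the vertex degrees\<close>

definition degree :: "'a set set \<Rightarrow> 'a \<Rightarrow> 'a rel" where
  "degree E v = |neighbors E v|"

text \<open>Cardinals are cardinal orders and are compared up to order isomorphism, so the least upper
  bound is only determined up to \<open>=o\<close>. The lemmas below show that it exists and that it is least
  also among cardinals on other types.\<close>

definition is_degree_lub :: "'a set \<Rightarrow> 'a set set \<Rightarrow> 'a rel \<Rightarrow> bool" where
  "is_degree_lub V E k \<longleftrightarrow>
     Card_order k \<and> (\<forall>v\<in>V. degree E v \<le>o k) \<and>
     (\<forall>k' :: 'a rel. Card_order k' \<and> (\<forall>v\<in>V. degree E v \<le>o k') \<longrightarrow> k \<le>o k')"

definition max_degree :: "'a set \<Rightarrow> 'a set set \<Rightarrow> 'a rel" where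
  "max_degree V E = (SOME k. is_degree_lub V E k)"

lemma is_degree_lub_max_degree: "is_degree_lub V E (max_degree V E)"
proof -
  define U where "U = {k :: 'a rel. Card_order k \<and> (\<forall>v\<in>V. degree E v \<le>o k)}"
  have "|UNIV :: 'a set| \<in> U"
    by (auto simp: U_def degree_def card_of_Card_order card_of_mono1)
  then obtain k where k: "k \<in> U" "\<And>k'. (k', k) \<in> ordLess \<Longrightarrow> k' \<notin> U"
    by (rule wfE_min[OF wf_ordLess]) blast
  have "k \<le>o k'" if "k' \<in> U" for k'
  proof -
    have "Well_order k" "Well_order k'"
      using k(1) that unfolding U_def card_order_on_def by blast+
    then show ?thesis
      using k(2)[of k'] that not_ordLess_iff_ordLeq[of k k'] by blast
  qed
  with k(1) have "is_degree_lub V E k"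
    by (auto simp: is_degree_lub_def U_def)
  then show ?thesis
    unfolding max_degree_def by (rule someI)
qed

lemma max_degree_ordLeq_iff:
  fixes r :: "'b rel"
  assumes r: "Card_order r"
  shows "max_degree V E \<le>o r \<longleftrightarrow> (\<forall>v\<in>V. degree E v \<le>o r)"
proof
  assume "max_degree V E \<le>o r"
  then show "\<forall>v\<in>V. degree E v \<le>o r"
    using is_degree_lub_max_degree[of V E] ordLeq_transitive
    unfolding is_degree_lub_def by blast
next
  assume b: "\<forall>v\<in>V. degree E v \<le>o r"
  let ?k = "max_degree V E"
  have k: "Card_order ?k"
    and least: "\<And>k' :: 'a rel. Card_order k' \<Longrightarrow> (\<forall>v\<in>V. degree E v \<le>o k') \<Longrightarrow> ?k \<le>o k'"
    using is_degree_lub_max_degree[of V E] unfolding is_degree_lub_def by auto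
  show "?k \<le>o r"
  proof (rule ccontr)
    assume "\<not> ?k \<le>o r"
    then have "r \<le>o ?k"
      using ordLeq_total[of ?k r] k r unfolding card_order_on_def by argo
    then have "|Field r| \<le>o |Field ?k|"
      using card_of_mono2 by blast
    then obtain f where f: "inj_on f (Field r)" "f ` Field r \<subseteq> Field ?k"
      using card_of_ordLeq[of "Field r" "Field ?k"] by blast
    then have "|Field r| =o |f ` Field r|"
      using card_of_ordIso inj_on_imp_bij_betw by blast
    then have eq: "r =o |f ` Field r|"
      using card_of_Field_ordIso[OF r] ordIso_symmetric ordIso_transitive by blast
    have "?k \<le>o |f ` Field r|"
      using b eq ordLeq_ordIso_trans by (intro least) (auto simp: card_of_Card_order)
    then show False
      using eq \<open>\<not> ?k \<le>o r\<close> ordIso_symmetric ordLeq_ordIso_trans by blast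
  qed
qed


section \<open>Asymmetrizing sets\<close>

text \<open>Only the values of an automorphism on \<open>V\<close> are relevant.\<close>

definition automorphism :: "'a set \<Rightarrow> 'a set set \<Rightarrow> ('a \<Rightarrow> 'a) \<Rightarrow> bool" where
  "automorphism V E \<phi> \<longleftrightarrow>
     bij_betw \<phi> V V \<and> (\<forall>u\<in>V. \<forall>v\<in>V. {u, v} \<in> E \<longleftrightarrow> {\<phi> u, \<phi> v} \<in> E)"

definition asymmetrizing :: "'a set \<Rightarrow> 'a set set \<Rightarrow> 'a set \<Rightarrow> bool" where
  "asymmetrizing V E S \<longleftrightarrow>
     S \<subseteq> V \<and> (\<forall>\<phi>. automorphism V E \<phi> \<and> \<phi> ` S = S \<longrightarrow> (\<forall>v\<in>V. \<phi> v = v))"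

definition asymm_equiv :: "'a set \<Rightarrow> 'a set set \<Rightarrow> ('a set \<times> 'a set) set" where
  "asymm_equiv V E =
     {(S, S'). asymmetrizing V E S \<and> asymmetrizing V E S' \<and>
               (\<exists>\<phi>. automorphism V E \<phi> \<and> \<phi> ` S = S')}"

lemma equiv_asymm_equiv: "equiv {S. asymmetrizing V E S} (asymm_equiv V E)"
proof (rule equivI)
  show "asymm_equiv V E \<subseteq> {S. asymmetrizing V E S} \<times> {S. asymmetrizing V E S}"
    by (auto simp: asymm_equiv_def)
  have "automorphism V E id"
    by (auto simp: automorphism_def)
  then show "refl_on {S. asymmetrizing V E S} (asymm_equiv V E)"
    by (auto simp: refl_on_def asymm_equiv_def intro!: exI[of _ id])
  show "sym (asymm_equiv V E)"
  proof (rule symI)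
    fix S T assume "(S, T) \<in> asymm_equiv V E"
    then obtain f where S: "asymmetrizing V E S" and T: "asymmetrizing V E T"
      and f: "automorphism V E f" "f ` S = T"
      by (auto simp: asymm_equiv_def)
    let ?g = "inv_into V f"
    have bij: "bij_betw f V V" and SV: "S \<subseteq> V"
      using f S by (auto simp: automorphism_def asymmetrizing_def)
    then have gbij: "bij_betw ?g V V"
      by (simp add: bij_betw_inv_into)
    have gV: "?g v \<in> V" "f (?g v) = v" if "v \<in> V" for v
      using that bij gbij by (auto simp: bij_betw_inv_into_right bij_betw_apply)
    have "{u, v} \<in> E \<longleftrightarrow> {?g u, ?g v} \<in> E" if "u \<in> V" "v \<in> V" for u v
      using f(1) gV that unfolding automorphism_def by metis
    then have "automorphism V E ?g"
      using gbij by (auto simp: automorphism_def)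
    moreover have "?g ` T = S"
      using f(2) bij SV by (auto simp: bij_betw_def)
    ultimately show "(T, S) \<in> asymm_equiv V E"
      using S T by (auto simp: asymm_equiv_def)
  qed
  show "trans (asymm_equiv V E)"
  proof (rule transI)
    fix S T U assume "(S, T) \<in> asymm_equiv V E" "(T, U) \<in> asymm_equiv V E"
    then obtain f g where SU: "asymmetrizing V E S" "asymmetrizing V E U"
      and f: "automorphism V E f" "f ` S = T" and g: "automorphism V E g" "g ` T = U"
      by (auto simp: asymm_equiv_def)
    have fg: "bij_betw f V V" "bij_betw g V V"
      using f(1) g(1) by (auto simp: automorphism_def)
    have "{u, v} \<in> E \<longleftrightarrow> {g (f u), g (f v)} \<in> E" if "u \<in> V" "v \<in> V" for u v
      using f(1) g(1) that bij_betw_apply[OF fg(1)] unfolding automorphism_def by metis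
    then have "automorphism V E (g \<circ> f)"
      using bij_betw_trans[OF fg] by (auto simp: automorphism_def)
    moreover have "(g \<circ> f) ` S = U"
      using f(2) g(2) by auto
    ultimately show "(S, U) \<in> asymm_equiv V E"
      using SU unfolding asymm_equiv_def by blast
  qed
qed

definition asymm_number :: "'a set \<Rightarrow> 'a set set \<Rightarrow> 'a set set rel" where
  "asymm_number V E = |{S. asymmetrizing V E S} // asymm_equiv V E|"

end

theory Submission
  imports Defs "HOL-Library.Infinite_Set"
begin

text \<open>Every vertex \<open>v\<close> has a child \<open>c v\<close> whose only lower neighbor is \<open>v\<close>. Hence, for any infinite set
  \<open>B\<close> of levels assigned to the root, \<open>S\<close> can be built so that the levels of the members of \<open>S\<close> below
  \<open>v\<close> (descending only through sole parents) form a prescribed infinite set \<open>B v\<close>: \<open>c v\<close> inherits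
  \<open>B v\<close> beyond the level of \<open>v\<close>, and the other vertices attached to \<open>v\<close>, of which there are at most
  \<open>2 ^ \<aleph>\<^sub>0\<close>, get pairwise distinct infinite subsets of it, each of which moreover encodes an arbitrary
  set of natural numbers. The sets \<open>B v\<close> are invariants, so by induction on the level an automorphism that
  fixes the root and preserves \<open>S\<close> is the identity, and the encoded sets can be read off. Distributing
  the bits of an arbitrary \<open>X \<subseteq> V\<close> over the codes yields \<open>2 ^ |V|\<close> inequivalent sets.
  Placing all members of \<open>S\<close> other than the root on odd levels makes the root recognizable.\<close>

section \<open>Selecting infinite subsets\<close>

lemma infinite_odd: "infinite {n :: nat. odd n}"
proof -
  have "inj (\<lambda>n :: nat. 2 * n + 1)" by (simp add: inj_def)
  then have "infinite (range (\<lambda>n :: nat. 2 * n + 1))"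
    by (simp add: finite_image_iff)
  then show ?thesis
    by (rule contrapos_nn) (auto elim: finite_subset[rotated])
qed

lemma infinite_Int_greaterThan:
  assumes "infinite (B :: nat set)"
  shows "infinite (B \<inter> {n<..})"
proof
  assume "finite (B \<inter> {n<..})"
  then have "finite (B \<inter> {n<..} \<union> {..n})" by simp
  moreover have "B \<subseteq> B \<inter> {n<..} \<union> {..n}" by auto
  ultimately show False
    using assms finite_subset by blast
qed

text \<open>Keeps exactly one element of each pair of consecutive elements of \<open>I\<close>; which one encodes \<open>A\<close>.\<close>

definition select :: "nat set \<Rightarrow> nat set \<Rightarrow> nat set" where
  "select I A = (\<lambda>n. enumerate I (2 * n + of_bool (n \<in> A))) ` UNIV"

lemma select_subset: "infinite I \<Longrightarrow> select I A \<subseteq> I"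
  by (auto simp: select_def enumerate_in_set)

lemma infinite_select:
  assumes "infinite I"
  shows "infinite (select I A)"
proof -
  have "inj (\<lambda>n. enumerate I (2 * n + of_bool (n \<in> A)))"
  proof (rule strict_mono_imp_inj_on[OF strict_monoI])
    fix m n :: nat
    assume "m < n"
    then have "2 * m + of_bool (m \<in> A) < 2 * n + (of_bool (n \<in> A) :: nat)"
      by (simp add: of_bool_def)
    with assms show "enumerate I (2 * m + of_bool (m \<in> A)) < enumerate I (2 * n + of_bool (n \<in> A))"
      by simp
  qed
  then show ?thesis
    unfolding select_def using finite_imageD infinite_UNIV_nat by blast
qed

text \<open>The pair of indices \<open>2 * n\<close> and \<open>2 * n + 1\<close> keeps the one
  chosen by bit \<open>n\<close>, and the pair containing \<open>k\<close> has
  \<open>n = k div 2\<close>.\<close>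

lemma enumerate_mem_select_iff:
  assumes "infinite I"
  shows "enumerate I k \<in> select I A \<longleftrightarrow> (odd k \<longleftrightarrow> k div 2 \<in> A)"
proof -
  have "inj (enumerate I)"
    using assms by (intro strict_mono_imp_inj_on[OF strict_monoI]) simp
  then have "enumerate I k \<in> select I A \<longleftrightarrow> (\<exists>n. k = 2 * n + of_bool (n \<in> A))"
    by (auto simp: select_def inj_eq)
  also have "\<dots> \<longleftrightarrow> (odd k \<longleftrightarrow> k div 2 \<in> A)"
  proof
    assume "odd k \<longleftrightarrow> k div 2 \<in> A"
    then have "k = 2 * (k div 2) + of_bool (k div 2 \<in> A)"
      by (cases "odd k") auto
    then show "\<exists>n. k = 2 * n + of_bool (n \<in> A)" ..
  qed auto
  finally show ?thesis .
qed

lemma select_eqD: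
  assumes "infinite I" "select I A = select I B"
  shows "A = B"
proof -
  have "n \<in> A \<longleftrightarrow> n \<in> B" for n
    using enumerate_mem_select_iff[OF assms(1), of "2 * n" A]
      enumerate_mem_select_iff[OF assms(1), of "2 * n" B] assms(2) by simp
  then show ?thesis by blast
qed

text \<open>Of the first two elements of \<open>I\<close> exactly one survives. This separates a
  vertex that inherits \<open>I\<close> whole from one that gets a selection.\<close>

lemma select_neq:
  assumes "infinite I"
  shows "select I A \<noteq> I"
proof
  assume eq: "select I A = I"
  have "enumerate I k \<in> select I A" for k
    using eq enumerate_in_set[OF assms] by simp
  then show False
    using enumerate_mem_select_iff[OF assms, of 0 A] enumerate_mem_select_iff[OF assms, of 1 A]
    by simp
qed

lemma if_select_eqD:
  assumes "infinite I" "(if P then I else select I A) = (if Q then I else select I B)"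
  shows "P \<longleftrightarrow> Q" "\<not> P \<Longrightarrow> A = B"
proof -
  show PQ: "P \<longleftrightarrow> Q"
    using assms(2) select_neq[OF assms(1)] by metis
  assume "\<not> P"
  with PQ assms(2) have "select I A = select I B"
    by simp
  then show "A = B"
    by (rule select_eqD[OF assms(1)])
qed

text \<open>The join of two sets: a single code stores both a label separating siblings and a
  payload.\<close>

definition interleave :: "nat set \<Rightarrow> nat set \<Rightarrow> nat set" where
  "interleave A B = {n. n div 2 \<in> (if even n then A else B)}"

lemma interleave_eq_iff: "interleave A B = interleave A' B' \<longleftrightarrow> A = A' \<and> B = B'"
proof
  assume eq: "interleave A B = interleave A' B'"
  have "n \<in> A \<longleftrightarrow> n \<in> A'" "n \<in> B \<longleftrightarrow> n \<in> B'" for n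
    using eq[unfolded interleave_def set_eq_iff, rule_format, of "2 * n"]
      eq[unfolded interleave_def set_eq_iff, rule_format, of "2 * n + 1"] by simp_all
  then show "A = A' \<and> B = B'" by blast
qed simp


section \<open>Distances and automorphisms\<close>

definition adj :: "'a set set \<Rightarrow> 'a rel" where
  "adj E = {(u, v). {u, v} \<in> E}"

text \<open>Walks instead of paths: relation powers compose and are preserved by automorphisms
  without any distinctness argument.\<close>

definition gdist :: "'a set set \<Rightarrow> 'a \<Rightarrow> 'a \<Rightarrow> nat" where
  "gdist E u v = (LEAST n. (u, v) \<in> adj E ^^ n)"

lemma gdist_le: "(u, v) \<in> adj E ^^ n \<Longrightarrow> gdist E u v \<le> n"
  unfolding gdist_def by (rule Least_le)

lemma gdist_self [simp]: "gdist E u u = 0"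
  using gdist_le[of u u 0 E] by simp

lemma path_relpow:
  assumes "is_path V E x p y"
  shows "(x, y) \<in> adj E ^^ (length p - 1)"
proof -
  have "successively (\<lambda>u v. {u, v} \<in> E) p" and p: "p \<noteq> []" "hd p = x" "last p = y"
    using assms by (auto simp: is_path_def)
  then have "\<forall>i<length p - 1. (p ! i, p ! Suc i) \<in> adj E"
    by (simp add: successively_conv_nth adj_def)
  then show ?thesis
    using p unfolding relpow_fun_conv
    by (intro exI[of _ "(!) p"]) (simp add: hd_conv_nth last_conv_nth)
qed

lemma connected_relpow_gdist:
  assumes "connected_graph V E" "u \<in> V" "v \<in> V"
  shows "(u, v) \<in> adj E ^^ gdist E u v"
proof -
  obtain p where "is_path V E u p v"
    using assms unfolding connected_graph_def by blast
  then show ?thesis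
    unfolding gdist_def by (rule LeastI[of "\<lambda>n. (u, v) \<in> adj E ^^ n", OF path_relpow])
qed

lemma simple_graph_edgeD:
  assumes "simple_graph V E" "{u, v} \<in> E"
  shows "u \<in> V" "v \<in> V" "u \<noteq> v"
proof -
  obtain a b where "a \<in> V" "b \<in> V" "a \<noteq> b" "{u, v} = {a, b}"
    using assms unfolding simple_graph_def by metis
  then show "u \<in> V" "v \<in> V" "u \<noteq> v"
    by (auto simp: doubleton_eq_iff)
qed

lemma automorphism_inv_into:
  assumes "automorphism V E f"
  shows "automorphism V E (inv_into V f)"
proof -
  have bij: "bij_betw f V V"
    using assms by (simp add: automorphism_def)
  then have gbij: "bij_betw (inv_into V f) V V"
    by (rule bij_betw_inv_into)
  have inv: "inv_into V f v \<in> V" "f (inv_into V f v) = v" if "v \<in> V" for v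
    using that bij gbij by (auto simp: bij_betw_inv_into_right bij_betw_apply)
  have "{u, v} \<in> E \<longleftrightarrow> {inv_into V f u, inv_into V f v} \<in> E" if "u \<in> V" "v \<in> V" for u v
    using assms inv[OF that(1)] inv[OF that(2)] unfolding automorphism_def by metis
  with gbij show ?thesis
    by (simp add: automorphism_def)
qed

lemma automorphism_edge:
  assumes "automorphism V E f" "simple_graph V E" "{u, v} \<in> E"
  shows "{f u, f v} \<in> E"
  using assms simple_graph_edgeD[OF assms(2,3)] by (auto simp: automorphism_def)

lemma automorphism_relpow:
  assumes "automorphism V E f" "simple_graph V E" "(u, v) \<in> adj E ^^ n"
  shows "(f u, f v) \<in> adj E ^^ n"
  using assms(3)
proof (induction n arbitrary: v)
  case (Suc n)
  from Suc.prems obtain y where "(u, y) \<in> adj E ^^ n" "{y, v} \<in> E"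
    by (auto simp: adj_def)
  then show ?case
    using Suc.IH[of y] automorphism_edge[OF assms(1,2), of y v] by (auto simp: adj_def)
qed simp

lemma automorphism_gdist:
  assumes f: "automorphism V E f" and conn: "connected_graph V E" and uv: "u \<in> V" "v \<in> V"
  shows "gdist E (f u) (f v) = gdist E u v"
proof -
  have sg: "simple_graph V E"
    using conn by (simp add: connected_graph_def)
  have le: "gdist E (g x) (g y) \<le> gdist E x y"
    if "automorphism V E g" "x \<in> V" "y \<in> V" for g x y
    using automorphism_relpow[OF that(1) sg connected_relpow_gdist[OF conn that(2,3)]]
    by (rule gdist_le)
  have bij: "bij_betw f V V"
    using f by (simp add: automorphism_def)
  then have "gdist E u v \<le> gdist E (f u) (f v)"
    using le[OF automorphism_inv_into[OF f], of "f u" "f v"] uv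
    by (simp add: bij_betw_apply bij_betw_inv_into_left)
  then show ?thesis
    using le[OF f uv] by simp
qed


section \<open>Lower neighbors\<close>

definition parents :: "'a set set \<Rightarrow> 'a \<Rightarrow> 'a \<Rightarrow> 'a set" where
  "parents E w x = {z. {x, z} \<in> E \<and> gdist E x w = Suc (gdist E z w)}"

definition sole_child :: "'a set set \<Rightarrow> 'a \<Rightarrow> 'a rel" where
  "sole_child E w = {(v, x). parents E w x = {v}}"

text \<open>The levels at which a vertex of \<open>S\<close> lies below \<open>v\<close>; restricting to descents through sole
  parents makes this both easy to prescribe and invariant under automorphisms fixing \<open>w\<close>.\<close>

definition profile :: "'a set set \<Rightarrow> 'a \<Rightarrow> 'a set \<Rightarrow> 'a \<Rightarrow> nat set" where
  "profile E w S v = {gdist E u w | u. (v, u) \<in> (sole_child E w)\<^sup>* \<and> u \<in> S}"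

locale rooted_graph =
  fixes V :: "'a set" and E :: "'a set set" and w :: 'a
  assumes connected: "connected_graph V E" and root: "w \<in> V"
begin

abbreviation level :: "'a \<Rightarrow> nat" where "level v \<equiv> gdist E v w"

lemma simple: "simple_graph V E"
  using connected by (simp add: connected_graph_def)

lemma level_eq_0_iff: "v \<in> V \<Longrightarrow> level v = 0 \<longleftrightarrow> v = w"
  using connected_relpow_gdist[OF connected _ root, of v] by auto

lemma gdist_edge_le:
  assumes "{u, v} \<in> E" "x \<in> V"
  shows "gdist E u x \<le> Suc (gdist E v x)"
  using assms connected_relpow_gdist[OF connected simple_graph_edgeD(2)[OF simple assms(1)] assms(2)]
  by (intro gdist_le relpow_Suc_I2[of u v]) (auto simp: adj_def)

lemma level_le_gdist:
  assumes "u \<in> V" "v \<in> V"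
  shows "level u \<le> gdist E u v + level v"
  using connected_relpow_gdist[OF connected assms] connected_relpow_gdist[OF connected assms(2) root]
  by (intro gdist_le) (auto simp: relpow_add)

lemma parents_subset: "parents E w v \<subseteq> V"
  using simple_graph_edgeD(2)[OF simple] by (auto simp: parents_def)

lemma sole_child_in_V: "(v, x) \<in> sole_child E w \<Longrightarrow> x \<in> V"
  using simple_graph_edgeD(1)[OF simple] by (auto simp: parents_def sole_child_def)

lemma parents_nonempty:
  assumes "v \<in> V" "v \<noteq> w"
  shows "parents E w v \<noteq> {}"
proof -
  obtain n where n: "level v = Suc n"
    using level_eq_0_iff[of v] assms not0_implies_Suc by blast
  then obtain z where z: "{v, z} \<in> E" "(z, w) \<in> adj E ^^ n"
    using relpow_Suc_D2[of v w n "adj E"] connected_relpow_gdist[OF connected assms(1) root]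
    by (auto simp: adj_def)
  \<comment> \<open>The remaining walk bounds the level of \<open>z\<close> from above, the edge
    from below.\<close>
  then have "level z = n"
    using gdist_le[OF z(2)] gdist_edge_le[OF z(1) root] n by simp
  with z n show ?thesis
    by (auto simp: parents_def)
qed

text \<open>The clause on levels strengthens the induction: it shows that the prepended vertex is
  new.\<close>

lemma shortest_path_to_root:
  assumes "v \<in> V"
  shows "\<exists>p. is_path V E v p w \<and> length p = Suc (level v) \<and>
    (\<forall>u\<in>set p. u = v \<or> level u < level v)"
  using assms
proof (induction "level v" arbitrary: v)
  case 0
  then have "v = w"
    using level_eq_0_iff by simp
  then show ?case
    using root by (intro exI[of _ "[w]"]) (auto simp: is_path_def)
next
  case (Suc n)
  then have "v \<noteq> w" by auto
  then obtain z where z: "z \<in> parents E w v"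
    using Suc.prems parents_nonempty by blast
  then have zn: "{v, z} \<in> E" "level z = n" "z \<in> V"
    using Suc.hyps(2) parents_subset by (auto simp: parents_def)
  then obtain p where p: "is_path V E z p w" "length p = Suc n"
    "\<forall>u\<in>set p. u = z \<or> level u < n"
    using Suc.hyps(1)[of z] by auto
  then have less: "\<forall>u\<in>set p. level u < level v"
    using Suc.hyps(2) zn(2) by auto
  then have "is_path V E v (v # p) w"
    using p zn Suc.prems by (auto simp: is_path_def successively_Cons)
  with p(2) less Suc.hyps(2) show ?case
    by (intro exI[of _ "v # p"]) auto
qed

lemma level_less_length:
  assumes "is_path V E v p w"
  shows "level v < length p"
  using gdist_le[OF path_relpow[OF assms]] assms by (cases p) (auto simp: is_path_def)

text \<open>Prepending \<open>x\<close> to a shortest path from any lower neighbor \<open>z\<close> gives a shortest path, on which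
  \<open>y\<close> can only be \<open>z\<close>.\<close>

lemma sole_childI:
  assumes xy: "{y, x} \<in> E"
    and through: "\<And>p. is_shortest_path V E x p w \<Longrightarrow> y \<in> set p"
  shows "(y, x) \<in> sole_child E w"
proof -
  have V: "x \<in> V" "y \<in> V" "x \<noteq> y" and xy': "{x, y} \<in> E"
    using simple_graph_edgeD[OF simple xy] xy by (auto simp: insert_commute)
  have "x \<noteq> w"
  proof
    assume "x = w"
    then have "is_shortest_path V E x [x] w"
      using V by (auto simp: is_shortest_path_def is_path_def Suc_le_eq)
    then show False
      using through[of "[x]"] V by simp
  qed
  moreover have "z = y" if z: "z \<in> parents E w x" for z
  proof -
    have zV: "z \<in> V" and edge: "{x, z} \<in> E" and lv: "level x = Suc (level z)"
      using z parents_subset by (auto simp: parents_def)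
    obtain p where p: "is_path V E z p w" "length p = Suc (level z)"
      "\<forall>u\<in>set p. u = z \<or> level u < level z"
      using shortest_path_to_root[OF zV] by blast
    then have "is_path V E x (x # p) w"
      using V lv edge by (auto simp: is_path_def successively_Cons)
    then have "is_shortest_path V E x (x # p) w"
      using p(2) level_less_length[of x] by (simp add: is_shortest_path_def Suc_le_eq flip: lv)
    then have "y \<in> set p"
      using through[of "x # p"] V by auto
    \<comment> \<open>Levels of neighbors differ by at most one, so \<open>y\<close> is not lower
      than \<open>z\<close>, whereas every other vertex of \<open>p\<close> is.\<close>
    moreover have "level z \<le> level y"
      using gdist_edge_le[OF xy' root] lv by simp
    ultimately show ?thesis
      using p(3) by force
  qed
  ultimately have "parents E w x = {y}"
    using parents_nonempty[OF V(1)] by blast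
  then show ?thesis
    by (simp add: sole_child_def)
qed

section \<open>Invariance under automorphisms fixing the root\<close>

context
  fixes f
  assumes f: "automorphism V E f" and fw: "f w = w"
begin

lemma bij_automorphism: "bij_betw f V V"
  using f by (simp add: automorphism_def)

lemma level_automorphism: "v \<in> V \<Longrightarrow> level (f v) = level v"
  using automorphism_gdist[OF f connected _ root, of v] fw by simp

lemma parents_automorphism:
  assumes "v \<in> V"
  shows "parents E w (f v) = f ` parents E w v"
proof
  show "f ` parents E w v \<subseteq> parents E w (f v)"
  proof clarify
    fix z assume z: "z \<in> parents E w v"
    then have "z \<in> V" "{f v, f z} \<in> E"
      using parents_subset automorphism_edge[OF f simple] by (auto simp: parents_def)
    with z show "f z \<in> parents E w (f v)"
      using level_automorphism assms by (simp add: parents_def)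
  qed
next
  show "parents E w (f v) \<subseteq> f ` parents E w v"
  proof
    fix z assume z: "z \<in> parents E w (f v)"
    then obtain y where y: "y \<in> V" "z = f y"
      using parents_subset[of "f v"] bij_automorphism by (auto simp: bij_betw_def)
    then have "{v, y} \<in> E"
      using z f assms by (simp add: parents_def automorphism_def)
    then have "y \<in> parents E w v"
      using z y assms level_automorphism by (simp add: parents_def)
    with y show "z \<in> f ` parents E w v" by blast
  qed
qed

lemma sole_child_automorphism:
  assumes "(v, u) \<in> (sole_child E w)\<^sup>*"
  shows "(f v, f u) \<in> (sole_child E w)\<^sup>*"
  using assms
proof induction
  case (step y z)
  then have "(f y, f z) \<in> sole_child E w"
    using sole_child_in_V[of y z] parents_automorphism[of z] by (simp add: sole_child_def)
  with step.IH show ?case by (rule rtrancl_into_rtrancl)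
qed simp

lemma profile_automorphism_subset:
  assumes "S \<subseteq> V"
  shows "profile E w S v \<subseteq> profile E w (f ` S) (f v)"
proof
  fix n assume "n \<in> profile E w S v"
  then obtain u where u: "n = level u" "(v, u) \<in> (sole_child E w)\<^sup>*" "u \<in> S"
    by (auto simp: profile_def)
  then have "n = level (f u)"
    using level_automorphism assms by auto
  then show "n \<in> profile E w (f ` S) (f v)"
    using u(3) sole_child_automorphism[OF u(2)] unfolding profile_def by blast
qed

end

text \<open>One inclusion holds for every root-fixing automorphism; the inverse of \<open>f\<close>
  gives the other.\<close>

lemma profile_automorphism:
  assumes f: "automorphism V E f" "f w = w" and S: "S \<subseteq> V" and v: "v \<in> V"
  shows "profile E w (f ` S) (f v) = profile E w S v"
proof
  have bij: "bij_betw f V V"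
    using f by (simp add: automorphism_def)
  have "inv_into V f w = w"
    using bij root f(2) bij_betw_inv_into_left[OF bij, of w] by simp
  moreover have "inv_into V f ` f ` S = S"
    using bij S by (simp add: bij_betw_def)
  ultimately show "profile E w (f ` S) (f v) \<subseteq> profile E w S v"
    using profile_automorphism_subset[OF automorphism_inv_into[OF f(1)], of "f ` S" "f v"]
      bij S v bij_betw_inv_into_left[OF bij v] by (auto simp: bij_betw_def)
qed (rule profile_automorphism_subset[OF f S])

end


section \<open>Prescribing the profiles\<close>

text \<open>\<open>c\<close> picks the child supplied by the tree-like condition; the labels
  \<open>A\<close> exist by the degree bound.\<close>

locale labelled_tree_like_graph = rooted_graph +
  fixes c :: "'a \<Rightarrow> 'a" and A :: "'a \<Rightarrow> 'a \<Rightarrow> nat set"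
  assumes sole_child_c: "v \<in> V \<Longrightarrow> (v, c v) \<in> sole_child E w"
    and inj_A: "v \<in> V \<Longrightarrow> inj_on (A v) (neighbors E v)"
begin

text \<open>The choice depends only on the set of parents, so an automorphism fixing all parents of
  \<open>x\<close> gives \<open>f x\<close> the same chosen parent.\<close>

definition parent :: "'a \<Rightarrow> 'a" where
  "parent x = (SOME z. z \<in> parents E w x)"

text \<open>The rays \<open>y, c y, c (c y), \<dots>\<close> starting outside the range of \<open>c\<close> partition \<open>V\<close>,
  so these codes together carry an arbitrary subset of \<open>V\<close>.\<close>

definition ray_code :: "'a set \<Rightarrow> 'a \<Rightarrow> nat set" where
  "ray_code X y = {n. (c ^^ n) y \<in> X}"

text \<open>Called with the level of \<open>v\<close>, so \<open>n\<close> is the level of the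
  parent and the cut \<open>{n<..}\<close> leaves the levels from that of \<open>v\<close> on. The 0
  puts the root itself into the coding set.\<close>

primrec prescribed_at :: "'a set \<Rightarrow> nat \<Rightarrow> 'a \<Rightarrow> nat set" where
  "prescribed_at X 0 v = insert 0 (select {n. odd n} (ray_code X v))"
| "prescribed_at X (Suc n) v =
    (let I = prescribed_at X n (parent v) \<inter> {n<..} in
     if v = c (parent v) then I
     else select I (interleave (A (parent v) v) (ray_code X v)))"

definition prescribed :: "'a set \<Rightarrow> 'a \<Rightarrow> nat set" where
  "prescribed X v = prescribed_at X (level v) v"

definition coding_set :: "'a set \<Rightarrow> 'a set" where
  "coding_set X = {v \<in> V. level v \<in> prescribed X v}"

lemma parent_in_parents: "v \<in> V \<Longrightarrow> v \<noteq> w \<Longrightarrow> parent v \<in> parents E w v"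
  unfolding parent_def using parents_nonempty by (metis ex_in_conv someI)

lemma
  assumes "v \<in> V" "v \<noteq> w"
  shows parent_in_V: "parent v \<in> V"
    and level_parent: "level v = Suc (level (parent v))"
    and parent_edge: "{parent v, v} \<in> E"
  using parent_in_parents[OF assms] parents_subset[of v]
  by (auto simp: parents_def insert_commute)

lemma parent_sole_child: "(v, x) \<in> sole_child E w \<Longrightarrow> parent x = v"
  by (simp add: parent_def sole_child_def)

lemma
  assumes "(v, x) \<in> sole_child E w"
  shows sole_child_level: "level x = Suc (level v)"
    and sole_child_edge: "{x, v} \<in> E"
  using assms by (auto simp: sole_child_def parents_def)

lemma
  assumes "v \<in> V"
  shows c_in_V: "c v \<in> V" and level_c: "level (c v) = Suc (level v)" and parent_c: "parent (c v) = v"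
  using sole_child_c[OF assms] sole_child_in_V sole_child_level parent_sole_child by auto

lemma prescribed_root: "prescribed X w = insert 0 (select {n. odd n} (ray_code X w))"
  by (simp add: prescribed_def)

lemma prescribed_nonroot:
  assumes "v \<in> V" "v \<noteq> w"
  shows "prescribed X v =
    (let I = prescribed X (parent v) \<inter> {level (parent v)<..} in
     if v = c (parent v) then I
     else select I (interleave (A (parent v) v) (ray_code X v)))"
  using level_parent[OF assms] by (simp add: prescribed_def)

lemma prescribed_invariant:
  assumes "v \<in> V"
  shows "infinite (prescribed X v) \<and> prescribed X v \<subseteq> {level v..} \<inter> insert 0 {n. odd n}"
  using assms
proof (induction "level v" arbitrary: v)
  case 0
  then have "v = w"
    using level_eq_0_iff by simp
  then show ?case
    using infinite_select[OF infinite_odd] select_subset[OF infinite_odd]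
    by (auto simp: prescribed_root)
next
  case (Suc n)
  then have nw: "v \<noteq> w" by auto
  define I where "I = prescribed X (parent v) \<inter> {level (parent v)<..}"
  have "infinite (prescribed X (parent v))" "prescribed X (parent v) \<subseteq> insert 0 {n. odd n}"
    using Suc.hyps(1)[of "parent v"] Suc.hyps(2) parent_in_V level_parent Suc.prems nw by auto
  then have I: "infinite I" "I \<subseteq> {level v..} \<inter> insert 0 {n. odd n}"
    using infinite_Int_greaterThan level_parent[OF Suc.prems nw] unfolding I_def by auto
  have "prescribed X v = I \<or> (\<exists>B. prescribed X v = select I B)"
    using prescribed_nonroot[OF Suc.prems nw] by (auto simp: I_def Let_def)
  then show ?case
    using I infinite_select select_subset[of I] by (metis subset_trans)
qed

lemma infinite_prescribed: "v \<in> V \<Longrightarrow> infinite (prescribed X v)"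
  using prescribed_invariant by blast

lemma prescribed_ge_level: "v \<in> V \<Longrightarrow> prescribed X v \<subseteq> {level v..}"
  using prescribed_invariant by blast

lemma prescribed_odd: "v \<in> V \<Longrightarrow> prescribed X v \<subseteq> insert 0 {n. odd n}"
  using prescribed_invariant by blast

lemma prescribed_c:
  assumes "v \<in> V"
  shows "prescribed X (c v) = prescribed X v \<inter> {level v<..}"
proof -
  have "c v \<noteq> w"
    using level_c[OF assms] by auto
  then show ?thesis
    using prescribed_nonroot[OF c_in_V[OF assms]] parent_c[OF assms] by simp
qed

lemma prescribed_subset_parent:
  assumes "v \<in> V" "v \<noteq> w"
  shows "prescribed X v \<subseteq> prescribed X (parent v)"
  using prescribed_nonroot[OF assms, of X]
    select_subset[OF infinite_Int_greaterThan[OF infinite_prescribed[OF parent_in_V[OF assms]]]]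
  by (fastforce simp: Let_def split: if_splits)

text \<open>Along the ray only levels already passed are dropped, so a prescribed level is still
  there when the ray reaches it.\<close>

lemma ray:
  assumes "v \<in> V"
  shows "(c ^^ k) v \<in> V \<and> level ((c ^^ k) v) = level v + k \<and>
    prescribed X ((c ^^ k) v) = prescribed X v \<inter> {level v + k..} \<and>
    (v, (c ^^ k) v) \<in> (sole_child E w)\<^sup>*"
proof (induction k)
  case 0
  then show ?case
    using assms prescribed_ge_level by auto
next
  case (Suc k)
  then have "(v, (c ^^ Suc k) v) \<in> (sole_child E w)\<^sup>*"
    using rtrancl_into_rtrancl[OF _ sole_child_c] by simp
  then show ?case
    using Suc c_in_V level_c prescribed_c by auto
qed

lemma ray_vertex_in_coding_set:
  assumes "v \<in> V" "m \<in> prescribed X v"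
  shows "(c ^^ (m - level v)) v \<in> coding_set X"
  using ray[OF assms(1), of "m - level v" X] assms(2) prescribed_ge_level[OF assms(1), of X]
  by (auto simp: coding_set_def)

lemma profile_coding_set:
  assumes "v \<in> V"
  shows "profile E w (coding_set X) v = prescribed X v"
proof
  \<comment> \<open>Prescriptions shrink from the chosen parent to the child, and in a descent
    through sole parents the chosen parent is the actual predecessor.\<close>
  have "prescribed X u \<subseteq> prescribed X v" if "(v, u) \<in> (sole_child E w)\<^sup>*" for u
    using that
  proof induction
    case (step y z)
    then have "z \<in> V" "z \<noteq> w" "parent z = y"
      using sole_child_in_V sole_child_level parent_sole_child by fastforce+
    then show ?case
      using prescribed_subset_parent step.IH by blast
  qed simp
  then show "profile E w (coding_set X) v \<subseteq> prescribed X v"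
    by (auto simp: profile_def coding_set_def)
next
  show "prescribed X v \<subseteq> profile E w (coding_set X) v"
  proof
    fix m assume m: "m \<in> prescribed X v"
    then have "level v \<le> m"
      using prescribed_ge_level[OF assms] by auto
    then have "m = level ((c ^^ (m - level v)) v)"
      using ray[OF assms, of "m - level v"] by simp
    moreover have "(v, (c ^^ (m - level v)) v) \<in> (sole_child E w)\<^sup>*"
      using ray[OF assms] by simp
    ultimately show "m \<in> profile E w (coding_set X) v"
      using ray_vertex_in_coding_set[OF assms m] unfolding profile_def by blast
  qed
qed

section \<open>Recognizing the root\<close>

lemma gdist_ray:
  assumes "v \<in> V"
  shows "gdist E ((c ^^ k) v) v = k"
proof -
  have "((c ^^ k) v, v) \<in> adj E ^^ k"
  proof (induction k)
    case (Suc k)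
    have "((c ^^ Suc k) v, (c ^^ k) v) \<in> adj E"
      using ray[OF assms, of k] sole_child_edge[OF sole_child_c] by (simp add: adj_def)
    then show ?case
      using Suc by (rule relpow_Suc_I2)
  qed simp
  \<comment> \<open>Walking back along the ray gives at most \<open>k\<close>, the difference of
    levels at least \<open>k\<close>.\<close>
  then show ?thesis
    using gdist_le level_le_gdist[of "(c ^^ k) v" v] ray[OF assms, of k] assms
    by (fastforce intro: antisym)
qed

text \<open>Seen from \<open>w\<close>, no vertex of a coding set has positive even level; seen from any other
  vertex \<open>v\<close> of a coding set, the ray from \<open>v\<close> contains members at positive even distance.\<close>

lemma coding_set_automorphism_fixes_root:
  assumes f: "automorphism V E f" and fS: "f ` coding_set X = coding_set Y"
  shows "f w = w"
proof (rule ccontr)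
  assume neq: "f w \<noteq> w"
  have fV: "f w \<in> V"
    using f root by (auto simp: automorphism_def bij_betw_apply)
  have "w \<in> coding_set X"
    using root by (simp add: coding_set_def prescribed_root)
  then have "f w \<in> coding_set Y"
    using fS by blast
  then have "odd (level (f w))"
    using prescribed_odd[OF fV, of Y] level_eq_0_iff[OF fV] neq by (auto simp: coding_set_def)
  obtain m where m: "m \<in> prescribed Y (f w)" "level (f w) < m"
    using infinite_Int_greaterThan[OF infinite_prescribed[OF fV], of Y "level (f w)"]
    by (metis IntE equals0I finite.emptyI greaterThan_iff)
  define k where "k = m - level (f w)"
  have "odd m"
    using prescribed_odd[OF fV, of Y] m by auto
  then have k: "even k" "0 < k"
    using m(2) \<open>odd (level (f w))\<close> by (auto simp: k_def)
  obtain u where u: "u \<in> coding_set X" "(c ^^ k) (f w) = f u"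
    using ray_vertex_in_coding_set[OF fV m(1)] fS unfolding k_def by (metis imageE)
  then have uV: "u \<in> V" and "level u \<in> prescribed X u"
    by (auto simp: coding_set_def)
  then have "level u = 0 \<or> odd (level u)"
    using prescribed_odd by blast
  \<comment> \<open>\<open>f\<close> maps \<open>u\<close> and \<open>w\<close> to the ends of a ray
    segment of length \<open>k\<close>.\<close>
  moreover have "level u = k"
    using automorphism_gdist[OF f connected uV root] gdist_ray[OF fV, of k] u(2) by simp
  ultimately show False
    using k by simp
qed

lemma coding_set_subset: "coding_set X \<subseteq> V"
  by (auto simp: coding_set_def)

text \<open>The claims support each other in one induction: fixed parents with equal prescriptions
  give \<open>v\<close> and \<open>f v\<close> the same pool \<open>I\<close>. As profiles are
  invariant, both are assigned the same subset of it, which reveals whether the vertex is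
  \<open>c\<close> of its parent and, if not, its label and ray code.\<close>

lemma coding_set_automorphism:
  assumes f: "automorphism V E f" and fS: "f ` coding_set X = coding_set Y" and "v \<in> V"
  shows "f v = v \<and> prescribed X v = prescribed Y v \<and>
    (v = w \<or> v \<noteq> c (parent v) \<longrightarrow> ray_code X v = ray_code Y v)"
  using assms(3)
proof (induction "level v" arbitrary: v)
  note fw = coding_set_automorphism_fixes_root[OF f fS]
  have prescribed_f: "prescribed X v = prescribed Y (f v)" if "v \<in> V" for v
  proof -
    have "f v \<in> V"
      using that f by (auto simp: automorphism_def bij_betw_apply)
    then show ?thesis
      using profile_automorphism[OF f fw coding_set_subset that, of X] that
      by (simp add: fS profile_coding_set)
  qed
  {
    case 0
    then have v: "v = w"
      using level_eq_0_iff by simp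
    have eq: "prescribed X w = prescribed Y w"
      using prescribed_f[OF root] fw by simp
    \<comment> \<open>Needed to cancel the inserted 0 on both sides.\<close>
    have "0 \<notin> select {n. odd n} B" for B
      using select_subset[OF infinite_odd, of B] by auto
    then have "select {n. odd n} (ray_code X w) = select {n. odd n} (ray_code Y w)"
      using eq by (metis prescribed_root insert_ident)
    then show ?case
      using v fw eq select_eqD[OF infinite_odd] by blast
  next
    case (Suc n)
    let ?p = "parent v"
    have nw: "v \<noteq> w" using Suc.hyps(2) by auto
    have fV: "f v \<in> V" and fnw: "f v \<noteq> w"
      using f Suc.prems Suc.hyps(2) level_automorphism[OF f fw Suc.prems]
      by (auto simp: automorphism_def bij_betw_apply)
    have pV: "?p \<in> V" and pl: "level ?p = n"
      using parent_in_V level_parent Suc.prems Suc.hyps(2) nw by auto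
    \<comment> \<open>Parents lie one level lower, so the induction hypothesis fixes them.\<close>
    have "f z = z" if "z \<in> parents E w v" for z
      using that Suc.hyps parents_subset[of v] by (auto simp: parents_def)
    then have "parents E w (f v) = parents E w v"
      using parents_automorphism[OF f fw Suc.prems] by simp
    then have pf: "parent (f v) = ?p"
      by (simp add: parent_def)
    define I where "I = prescribed X ?p \<inter> {level ?p<..}"
    have pI: "prescribed Y ?p \<inter> {level ?p<..} = I"
      using Suc.hyps(1)[of ?p] pV pl by (simp add: I_def)
    have "prescribed X v = (if v = c ?p then I else select I (interleave (A ?p v) (ray_code X v)))"
      using prescribed_nonroot[OF Suc.prems nw, of X] by (simp only: I_def Let_def)
    moreover have "prescribed Y (f v) =
        (if f v = c ?p then I else select I (interleave (A ?p (f v)) (ray_code Y (f v))))"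
      using prescribed_nonroot[OF fV fnw, of Y] by (simp only: pf pI Let_def)
    ultimately have eq: "(if v = c ?p then I else select I (interleave (A ?p v) (ray_code X v))) =
        (if f v = c ?p then I else select I (interleave (A ?p (f v)) (ray_code Y (f v))))"
      using prescribed_f[OF Suc.prems] by (simp only:)
    have I: "infinite I"
      unfolding I_def by (rule infinite_Int_greaterThan[OF infinite_prescribed[OF pV]])
    have "f v = v \<and> (v \<noteq> c ?p \<longrightarrow> ray_code X v = ray_code Y v)"
    proof (cases "v = c ?p")
      case True
      \<comment> \<open>Only \<open>c ?p\<close> inherits all of \<open>I\<close>, so
        \<open>f v\<close> is that vertex too.\<close>
      with if_select_eqD(1)[OF I eq] show ?thesis by argo
    next
      case False
      then have "A ?p v = A ?p (f v)" "ray_code X v = ray_code Y (f v)"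
        using if_select_eqD(2)[OF I eq] by (simp_all add: interleave_eq_iff)
      moreover have "v \<in> neighbors E ?p" "f v \<in> neighbors E ?p"
        using parent_edge[OF Suc.prems nw] parent_edge[OF fV fnw] pf by (auto simp: neighbors_def)
      ultimately show ?thesis
        using inj_A[OF pV] by (metis inj_onD)
    qed
    then show ?case
      using prescribed_f[OF Suc.prems] nw by simp
  }
qed

section \<open>Decoding and inequivalence\<close>

lemma exists_ray:
  assumes "v \<in> V"
  shows "\<exists>y\<in>V. \<exists>n. v = (c ^^ n) y \<and> (y = w \<or> y \<noteq> c (parent y))"
  using assms
proof (induction "level v" arbitrary: v)
  case 0
  then show ?case
    using level_eq_0_iff by (intro bexI[of _ v] exI[of _ 0]) auto
next
  case (Suc n)
  then have nw: "v \<noteq> w" by auto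
  show ?case
  proof (cases "v = c (parent v)")
    case True
    obtain y k where "y \<in> V" "parent v = (c ^^ k) y" "y = w \<or> y \<noteq> c (parent y)"
      using Suc parent_in_V[OF _ nw] level_parent[OF _ nw] by (metis Suc_inject)
    then show ?thesis
      using True by (intro bexI[of _ y] exI[of _ "Suc k"]) auto
  next
    case False
    then show ?thesis
      using Suc.prems by (intro bexI[of _ v] exI[of _ 0]) auto
  qed
qed

lemma asymmetrizing_coding_set: "asymmetrizing V E (coding_set X)"
  using coding_set_subset coding_set_automorphism by (auto simp: asymmetrizing_def)

text \<open>Each \<open>v\<close> is the \<open>n\<close>-th vertex of a ray whose code is
  preserved, and bit \<open>n\<close> of that code decides whether \<open>v\<close> is in
  \<open>X\<close>.\<close>

lemma coding_set_equiv_imp_eq: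
  assumes "(coding_set X, coding_set Y) \<in> asymm_equiv V E" "X \<subseteq> V" "Y \<subseteq> V"
  shows "X = Y"
proof -
  obtain f where f: "automorphism V E f" "f ` coding_set X = coding_set Y"
    using assms(1) by (auto simp: asymm_equiv_def)
  have "v \<in> X \<longleftrightarrow> v \<in> Y" if "v \<in> V" for v
  proof -
    obtain y n where "y \<in> V" "v = (c ^^ n) y" "y = w \<or> y \<noteq> c (parent y)"
      using exists_ray[OF \<open>v \<in> V\<close>] by metis
    then show ?thesis
      using coding_set_automorphism[OF f, of y] by (auto simp: ray_code_def)
  qed
  with assms(2,3) show ?thesis by blast
qed

lemma Pow_ordLeq_asymm_number: "|Pow V| \<le>o asymm_number V E"
proof -
  define cls where "cls X = asymm_equiv V E `` {coding_set X}" for X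
  have "inj_on cls (Pow V)"
  proof (rule inj_onI)
    fix X Y assume XY: "X \<in> Pow V" "Y \<in> Pow V" "cls X = cls Y"
    then have "(coding_set X, coding_set Y) \<in> asymm_equiv V E"
      using eq_equiv_class[OF _ equiv_asymm_equiv] asymmetrizing_coding_set
      unfolding cls_def by blast
    with XY show "X = Y"
      using coding_set_equiv_imp_eq by blast
  qed
  moreover have "cls ` Pow V \<subseteq> {S. asymmetrizing V E S} // asymm_equiv V E"
    using asymmetrizing_coding_set by (auto simp: cls_def intro: quotientI)
  ultimately show ?thesis
    unfolding asymm_number_def using card_of_ordLeq by blast
qed

end


section \<open>Counting\<close>

text \<open>General in \<open>r\<close> so as to serve both \<open>natLeq\<close> and
  \<open>|V|\<close>.\<close>

lemma ctwo_cexp_ordIso_Pow: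
  assumes "Field r = F"
  shows "|Pow F| =o ctwo ^c r"
  using assms card_of_Pow_Func[of F] by (simp add: cexp_def ctwo_def Field_card_of)

lemma asymm_number_ordLeq_Pow: "asymm_number V E \<le>o |Pow V|"
proof -
  have "{S. asymmetrizing V E S} // asymm_equiv V E
      = (\<lambda>S. asymm_equiv V E `` {S}) ` {S. asymmetrizing V E S}"
    by (auto simp: quotient_def)
  then have "asymm_number V E \<le>o |{S. asymmetrizing V E S}|"
    unfolding asymm_number_def using card_of_image by metis
  also have "|{S. asymmetrizing V E S}| \<le>o |Pow V|"
    by (rule card_of_mono1) (auto simp: asymmetrizing_def)
  finally show ?thesis .
qed

theorem theorem4p2:
  fixes V :: "'a set" and E :: "'a set set" and w :: 'a
  assumes "tree_like V E w"
    and "max_degree V E \<le>o ctwo ^c natLeq"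
  shows "asymm_number V E =o ctwo ^c |V|"
proof -
  interpret rooted_graph V E w
    using assms(1) by unfold_locales (auto simp: tree_like_def)
  have "\<exists>x. (y, x) \<in> sole_child E w" if "y \<in> V" for y
    using assms(1) that sole_childI[of y] by (force simp: tree_like_def neighbors_def)
  then obtain c where c: "\<And>y. y \<in> V \<Longrightarrow> (y, c y) \<in> sole_child E w"
    by metis
  \<comment> \<open>The degree bound turns into an injection into sets of naturals.\<close>
  have "\<exists>g :: 'a \<Rightarrow> nat set. inj_on g (neighbors E v)" if "v \<in> V" for v
  proof -
    have "|neighbors E v| \<le>o ctwo ^c natLeq"
      using assms(2) that max_degree_ordLeq_iff[OF Card_order_cexp, of V E ctwo natLeq]
      unfolding degree_def by blast
    then have "|neighbors E v| \<le>o |Pow (UNIV :: nat set)|"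
      using ctwo_cexp_ordIso_Pow[OF Field_natLeq] ordIso_symmetric ordLeq_ordIso_trans by blast
    then show ?thesis
      unfolding card_of_ordLeq[symmetric] by blast
  qed
  then obtain A :: "'a \<Rightarrow> 'a \<Rightarrow> nat set" where A: "\<And>v. v \<in> V \<Longrightarrow> inj_on (A v) (neighbors E v)"
    by metis
  interpret labelled_tree_like_graph V E w c A
    using c A by unfold_locales
  have "asymm_number V E =o |Pow V|"
    using asymm_number_ordLeq_Pow Pow_ordLeq_asymm_number by (simp add: ordIso_iff_ordLeq)
  also have "|Pow V| =o ctwo ^c |V|"
    by (rule ctwo_cexp_ordIso_Pow) (rule Field_card_of)
  finally show ?thesis .
qed

end
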